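(* Let $K$ be a field, $\sigma$ an automorphism of $K$, $R=K[t;\sigma]$, and let $f(t)=t^m-\sum_{i=0}^{m-1}a_it^i\in R$ be a monic polynomial of degree $m\ge 2$ which is not right invariant. Let $k\in\{1,2,\dots,m-1\}$. If $a_i\in \mathrm{Fix}(\sigma^k)$ for all $i\in\{0,1,\dots,m-1\}$, then $t^k\in \mathrm{Nuc}_r(S_f)$. In particular, then $t^mt^k=t^kt^m$ in $S_f$.
   Context: $R=K[t;\sigma]$ is the twisted polynomial ring: polynomials $\sum b_it^i$ with $b_i\in K$, termwise addition, and multiplication determined by $ta=\sigma(a)t$ for $a\in K$. For an automorphism $\tau$ of $K$, $\mathrm{Fix}(\tau)=\{a\in K:\tau(a)=a\}$. $f$ is right invariant if $Rf$ is a two-sided ideal of $R$. For $g\in R$, $g\,\mathrm{mod}_r f$ is the remainder of $g$ under right division by $f$ (the unique $r$ with $g=qf+r$, $\deg r<m$). The Petit algebra $S_f$ is the unital nonassociative ring with underlying additive group $\{g\in R:\deg g<m\}$ and multiplication $g\circ h=gh\,\mathrm{mod}_r f$ (written as juxtaposition). In $S_f$, $t^m$ denotes the element $t^m\,\mathrm{mod}_r f=\sum_{i=0}^{m-1}a_it^i$. The right nucleus is $\mathrm{Nuc}_r(S_f)=\{x\in S_f: (yz)x=y(zx)\text{ for all }y,z\in S_f\}$; for $f$ not right invariant it equals the eigenspace $\{g\in R:\deg g<m,\ fg\in Rf\}$. *)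

theory Defs
  imports "HOL-Computational_Algebra.Polynomial" "HOL-Algebra.Ideal"
begin

definition field_automorphism :: "('a::field \<Rightarrow> 'a) \<Rightarrow> bool" where
  "field_automorphism \<sigma> \<longleftrightarrow>
     bij \<sigma> \<and> \<sigma> 1 = 1 \<and> (\<forall>x y. \<sigma> (x + y) = \<sigma> x + \<sigma> y) \<and> (\<forall>x y. \<sigma> (x * y) = \<sigma> x * \<sigma> y)"

definition Fix :: "('a \<Rightarrow> 'a) \<Rightarrow> 'a set" where
  "Fix \<tau> = {a. \<tau> a = a}"

text \<open>
  Elements of \<open>K[t;\<sigma>]\<close> are represented by the type of ordinary polynomials, with coefficients written
  on the left: \<open>monom b i\<close> stands for \<open>b t^i\<close>. Only the additive structure, the coefficients and the
  degree of that type are used; its commutative multiplication plays no role. The product is the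
  biadditive extension of \<open>(b t^i)(c t^j) = b \<sigma>^i(c) t^(i+j)\<close>, which is what \<open>t a = \<sigma>(a) t\<close> forces.
\<close>

definition skew_mult :: "('a::field \<Rightarrow> 'a) \<Rightarrow> 'a poly \<Rightarrow> 'a poly \<Rightarrow> 'a poly" where
  "skew_mult \<sigma> p q =
     (\<Sum>i\<le>degree p. \<Sum>j\<le>degree q. monom (coeff p i * (\<sigma> ^^ i) (coeff q j)) (i + j))"

definition skew_poly_ring :: "('a::field \<Rightarrow> 'a) \<Rightarrow> 'a poly ring" where
  "skew_poly_ring \<sigma> =
     \<lparr>carrier = UNIV, mult = skew_mult \<sigma>, one = 1, zero = 0, add = (+)\<rparr>"

definition right_invariant :: "('a::field \<Rightarrow> 'a) \<Rightarrow> 'a poly \<Rightarrow> bool" where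
  "right_invariant \<sigma> f \<longleftrightarrow> ideal {skew_mult \<sigma> q f |q. True} (skew_poly_ring \<sigma>)"

text \<open>
  The description below is meant for \<open>degree f > 0\<close>, where the remainder exists uniquely; see
  \<open>ex1_skew_remainder\<close>. The zero polynomial has degree \<open>0\<close> here, so it is an admissible remainder.
\<close>

definition skew_mod :: "('a::field \<Rightarrow> 'a) \<Rightarrow> 'a poly \<Rightarrow> 'a poly \<Rightarrow> 'a poly" where
  "skew_mod \<sigma> g f = (THE r. degree r < degree f \<and> (\<exists>q. g = skew_mult \<sigma> q f + r))"

text \<open>
  The record type \<open>ring\<close> is used purely as a signature for the Petit algebra, whose multiplication
  need not be associative.
\<close>

definition petit_algebra :: "('a::field \<Rightarrow> 'a) \<Rightarrow> 'a poly \<Rightarrow> 'a poly ring" where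
  "petit_algebra \<sigma> f =
     \<lparr>carrier = {g. degree g < degree f}, mult = (\<lambda>g h. skew_mod \<sigma> (skew_mult \<sigma> g h) f),
      one = 1, zero = 0, add = (+)\<rparr>"

definition right_nucleus :: "('a, 'b) monoid_scheme \<Rightarrow> 'a set" where
  "right_nucleus S = {x \<in> carrier S. \<forall>y\<in>carrier S. \<forall>z\<in>carrier S.
     (y \<otimes>\<^bsub>S\<^esub> z) \<otimes>\<^bsub>S\<^esub> x = y \<otimes>\<^bsub>S\<^esub> (z \<otimes>\<^bsub>S\<^esub> x)}"

lemma field_automorphism_funpow:
  assumes "field_automorphism \<sigma>"
  shows "field_automorphism (\<sigma> ^^ n)"
  using assms by (induction n) (auto simp: field_automorphism_def intro: bij_comp)

lemma field_automorphism_zero: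
  assumes "field_automorphism \<sigma>"
  shows "\<sigma> 0 = 0"
proof -
  have "\<sigma> (0 + 0) = \<sigma> 0 + \<sigma> 0"
    using assms unfolding field_automorphism_def by blast
  then show ?thesis by (simp only: add_0_left add_cancel_right_right)
qed

lemma field_automorphism_eq_zero_iff:
  assumes "field_automorphism \<sigma>"
  shows "\<sigma> x = 0 \<longleftrightarrow> x = 0"
  using assms field_automorphism_zero[OF assms]
  unfolding field_automorphism_def bij_def inj_def by metis

context
  fixes \<sigma> :: "'a::field \<Rightarrow> 'a"
  assumes aut: "field_automorphism \<sigma>"
begin

lemma funpow_aut_zero [simp]: "(\<sigma> ^^ n) 0 = 0"
  and funpow_aut_one [simp]: "(\<sigma> ^^ n) 1 = 1"
  and funpow_aut_add: "(\<sigma> ^^ n) (x + y) = (\<sigma> ^^ n) x + (\<sigma> ^^ n) y"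
  and funpow_aut_mult: "(\<sigma> ^^ n) (x * y) = (\<sigma> ^^ n) x * (\<sigma> ^^ n) y"
  using field_automorphism_funpow[OF aut, of n] field_automorphism_zero
  by (auto simp: field_automorphism_def)

lemma coeff_skew_mult:
  "coeff (skew_mult \<sigma> p q) n = (\<Sum>i\<le>n. coeff p i * (\<sigma> ^^ i) (coeff q (n - i)))"
proof -
  have inner: "(\<Sum>j\<le>degree q. if i + j = n then coeff p i * (\<sigma> ^^ i) (coeff q j) else 0)
      = (if i \<le> n then coeff p i * (\<sigma> ^^ i) (coeff q (n - i)) else 0)" (is "?L = ?R") for i
  proof (cases "i \<le> n")
    case True
    then have "?L = (\<Sum>j\<le>degree q. if n - i = j then coeff p i * (\<sigma> ^^ i) (coeff q j) else 0)"
      by (intro sum.cong) auto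
    also have "\<dots> = ?R"
      using True by (auto simp: coeff_eq_0)
    finally show ?thesis .
  qed auto
  have "coeff (skew_mult \<sigma> p q) n
      = (\<Sum>i\<le>degree p. if i \<le> n then coeff p i * (\<sigma> ^^ i) (coeff q (n - i)) else 0)"
    by (simp add: skew_mult_def coeff_sum inner)
  also have "\<dots> = (\<Sum>i\<in>{..degree p} \<inter> {..n}. coeff p i * (\<sigma> ^^ i) (coeff q (n - i)))"
    by (subst sum.inter_restrict) auto
  also have "\<dots> = (\<Sum>i\<le>n. coeff p i * (\<sigma> ^^ i) (coeff q (n - i)))"
    by (intro sum.mono_neutral_left) (auto simp: coeff_eq_0)
  finally show ?thesis .
qed

lemma skew_mult_add_left: "skew_mult \<sigma> (p + q) r = skew_mult \<sigma> p r + skew_mult \<sigma> q r"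
  by (rule poly_eqI) (simp add: coeff_skew_mult algebra_simps sum.distrib)

lemma skew_mult_add_right: "skew_mult \<sigma> p (q + r) = skew_mult \<sigma> p q + skew_mult \<sigma> p r"
  by (rule poly_eqI) (simp add: coeff_skew_mult funpow_aut_add algebra_simps sum.distrib)

lemma skew_mult_zero_left [simp]: "skew_mult \<sigma> 0 p = 0"
  and skew_mult_zero_right [simp]: "skew_mult \<sigma> p 0 = 0"
  by (simp_all add: poly_eq_iff coeff_skew_mult)

lemma skew_mult_diff_left: "skew_mult \<sigma> (p - q) r = skew_mult \<sigma> p r - skew_mult \<sigma> q r"
  using skew_mult_add_left[of "p - q" q r] by (simp add: algebra_simps)

lemma skew_mult_sum_left: "skew_mult \<sigma> (sum g A) p = (\<Sum>i\<in>A. skew_mult \<sigma> (g i) p)"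
  by (induction A rule: infinite_finite_induct) (simp_all add: skew_mult_add_left)

lemma skew_mult_sum_right: "skew_mult \<sigma> p (sum g A) = (\<Sum>i\<in>A. skew_mult \<sigma> p (g i))"
  by (induction A rule: infinite_finite_induct) (simp_all add: skew_mult_add_right)

lemma skew_mult_monom:
  "skew_mult \<sigma> (monom b i) (monom c j) = monom (b * (\<sigma> ^^ i) c) (i + j)"
proof (rule poly_eqI)
  fix n
  have "coeff (skew_mult \<sigma> (monom b i) (monom c j)) n
      = (\<Sum>l\<le>n. if l = i then (if i + j = n then b * (\<sigma> ^^ i) c else 0) else 0)"
    unfolding coeff_skew_mult by (intro sum.cong) auto
  then show "coeff (skew_mult \<sigma> (monom b i) (monom c j)) n
      = coeff (monom (b * (\<sigma> ^^ i) c) (i + j)) n"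
    by auto
qed

lemma skew_twist: "skew_mult \<sigma> (monom 1 1) [:b:] = skew_mult \<sigma> [:\<sigma> b:] (monom 1 1)"
  using skew_mult_monom[of 1 1 b 0] skew_mult_monom[of "\<sigma> b" 0 1 1] by (simp add: monom_0)

lemma skew_mult_assoc:
  "skew_mult \<sigma> (skew_mult \<sigma> p q) r = skew_mult \<sigma> p (skew_mult \<sigma> q r)"
proof -
  have "skew_mult \<sigma> (skew_mult \<sigma> (monom b i) (monom c j)) (monom d l)
      = skew_mult \<sigma> (monom b i) (skew_mult \<sigma> (monom c j) (monom d l))" for b c d i j l
    by (simp add: skew_mult_monom funpow_aut_mult funpow_add mult.assoc add.assoc)
  then have "skew_mult \<sigma> (skew_mult \<sigma> (\<Sum>i\<le>degree p. monom (coeff p i) i)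
        (\<Sum>i\<le>degree q. monom (coeff q i) i)) (\<Sum>i\<le>degree r. monom (coeff r i) i)
      = skew_mult \<sigma> (\<Sum>i\<le>degree p. monom (coeff p i) i)
        (skew_mult \<sigma> (\<Sum>i\<le>degree q. monom (coeff q i) i) (\<Sum>i\<le>degree r. monom (coeff r i) i))"
    by (simp add: skew_mult_sum_left skew_mult_sum_right)
  then show ?thesis
    by (simp add: poly_as_sum_of_monoms)
qed

lemma skew_mult_one_left [simp]: "skew_mult \<sigma> 1 p = p"
proof (rule poly_eqI)
  fix n
  have "coeff (skew_mult \<sigma> 1 p) n = (\<Sum>i\<le>n. if i = 0 then coeff p n else 0)"
    unfolding coeff_skew_mult by (intro sum.cong) (auto simp: coeff_1)
  then show "coeff (skew_mult \<sigma> 1 p) n = coeff p n" by simp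
qed

lemma skew_mult_one_right [simp]: "skew_mult \<sigma> p 1 = p"
proof (rule poly_eqI)
  fix n
  have "coeff (skew_mult \<sigma> p 1) n = (\<Sum>i\<le>n. if i = n then coeff p n else 0)"
    unfolding coeff_skew_mult by (intro sum.cong) (auto simp: coeff_1)
  then show "coeff (skew_mult \<sigma> p 1) n = coeff p n" by simp
qed

lemma ring_skew_poly_ring: "ring (skew_poly_ring \<sigma>)"
proof (rule ringI)
  show "abelian_group (skew_poly_ring \<sigma>)"
  proof (rule abelian_groupI)
    fix x assume "x \<in> carrier (skew_poly_ring \<sigma>)"
    show "\<exists>y\<in>carrier (skew_poly_ring \<sigma>). y \<oplus>\<^bsub>skew_poly_ring \<sigma>\<^esub> x = \<zero>\<^bsub>skew_poly_ring \<sigma>\<^esub>"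
      by (rule bexI[of _ "- x"]) (simp_all add: skew_poly_ring_def)
  qed (simp_all add: skew_poly_ring_def algebra_simps)
  show "monoid (skew_poly_ring \<sigma>)"
    by (rule monoidI) (simp_all add: skew_poly_ring_def skew_mult_assoc)
qed (simp_all add: skew_poly_ring_def skew_mult_add_left skew_mult_add_right)

lemma skew_power_t: "monom 1 1 [^]\<^bsub>skew_poly_ring \<sigma>\<^esub> (n::nat) = monom 1 n"
proof (induction n)
  case 0
  then show ?case by (simp add: skew_poly_ring_def)
next
  case (Suc n)
  then show ?case
    using skew_mult_monom[of 1 n 1 1] by (simp add: skew_poly_ring_def)
qed

lemma degree_skew_mult_le: "degree (skew_mult \<sigma> p q) \<le> degree p + degree q"
  unfolding skew_mult_def
  by (intro degree_sum_le finite_atMost order.trans[OF degree_monom_le]) auto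

lemma coeff_skew_mult_top:
  "coeff (skew_mult \<sigma> p q) (degree p + degree q) = lead_coeff p * (\<sigma> ^^ degree p) (lead_coeff q)"
proof -
  have "coeff (skew_mult \<sigma> p q) (degree p + degree q)
      = (\<Sum>i\<le>degree p + degree q. if i = degree p
           then lead_coeff p * (\<sigma> ^^ degree p) (lead_coeff q) else 0)"
    unfolding coeff_skew_mult
  proof (intro sum.cong)
    fix i assume "i \<in> {..degree p + degree q}"
    show "coeff p i * (\<sigma> ^^ i) (coeff q (degree p + degree q - i)) = (if i = degree p
           then lead_coeff p * (\<sigma> ^^ degree p) (lead_coeff q) else 0)"
      by (cases i "degree p" rule: linorder_cases) (auto simp: coeff_eq_0)
  qed simp
  then show ?thesis by simp
qed

lemma degree_skew_mult:
  assumes "p \<noteq> 0" "q \<noteq> 0"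
  shows "degree (skew_mult \<sigma> p q) = degree p + degree q"
proof (rule antisym[OF degree_skew_mult_le le_degree])
  have "(\<sigma> ^^ degree p) (lead_coeff q) \<noteq> 0"
    using assms field_automorphism_eq_zero_iff[OF field_automorphism_funpow[OF aut]] by simp
  then show "coeff (skew_mult \<sigma> p q) (degree p + degree q) \<noteq> 0"
    using assms by (simp add: coeff_skew_mult_top)
qed

lemma ex_skew_remainder:
  assumes "degree f > 0"
  shows "\<exists>q r. degree r < degree f \<and> g = skew_mult \<sigma> q f + r"
proof (induction "degree g" arbitrary: g rule: less_induct)
  case less
  show ?case
  proof (cases "degree g < degree f")
    case True
    then show ?thesis by (intro exI[of _ 0] exI[of _ g]) simp
  next
    case False
    define d where "d = degree g - degree f"
    define c where "c = lead_coeff g / (\<sigma> ^^ d) (lead_coeff f)"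
    define h where "h = g - skew_mult \<sigma> (monom c d) f"
    have f0: "f \<noteq> 0" and dg: "d + degree f = degree g" and g0: "degree g > 0" "g \<noteq> 0"
      using assms False by (auto simp: d_def)
    have lf: "(\<sigma> ^^ d) (lead_coeff f) \<noteq> 0"
      using f0 field_automorphism_eq_zero_iff[OF field_automorphism_funpow[OF aut]] by simp
    then have c0: "c \<noteq> 0"
      using g0 by (simp add: c_def)
    have "coeff (skew_mult \<sigma> (monom c d) f) (degree g) = lead_coeff g"
      using coeff_skew_mult_top[of "monom c d" f] c0 lf dg by (simp add: degree_monom_eq c_def)
    then have top: "coeff h (degree g) = 0"
      by (simp add: h_def)
    have "degree h \<le> degree g"
      unfolding h_def using degree_skew_mult_le[of "monom c d" f] c0 dg
      by (intro degree_diff_le) (auto simp: degree_monom_eq)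
    with top g0 have "degree h < degree g"
      by (metis degree_0 leading_coeff_0_iff le_neq_implies_less)
    from less[OF this] obtain q r where "degree r < degree f" "h = skew_mult \<sigma> q f + r"
      by blast
    then have "degree r < degree f \<and> g = skew_mult \<sigma> (monom c d + q) f + r"
      by (simp add: h_def skew_mult_add_left algebra_simps)
    then show ?thesis by blast
  qed
qed

lemma ex1_skew_remainder:
  assumes "degree f > 0"
  shows "\<exists>!r. degree r < degree f \<and> (\<exists>q. g = skew_mult \<sigma> q f + r)"
proof (rule ex_ex1I)
  show "\<exists>r. degree r < degree f \<and> (\<exists>q. g = skew_mult \<sigma> q f + r)"
    using ex_skew_remainder[OF assms] by blast
next
  fix r s
  assume r: "degree r < degree f \<and> (\<exists>q. g = skew_mult \<sigma> q f + r)"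
    and s: "degree s < degree f \<and> (\<exists>q. g = skew_mult \<sigma> q f + s)"
  then obtain q q' where "skew_mult \<sigma> q f + r = skew_mult \<sigma> q' f + s"
    by metis
  then have eq: "skew_mult \<sigma> (q - q') f = s - r"
    by (simp add: skew_mult_diff_left algebra_simps)
  have "degree (s - r) < degree f"
    using r s by (intro degree_diff_less) auto
  then have "q - q' = 0"
    using degree_skew_mult[of "q - q'" f] eq assms by force
  then show "r = s"
    using eq by simp
qed

end

end

theory Submission imports Defs begin

text \<open>
  Multiplication in the Petit algebra is multiplication in \<open>K[t;\<sigma>]\<close> followed by reduction modulo
  the left ideal \<open>Rf\<close>. Reducing the right factor of a product beforehand never changes the result,
  because \<open>Rf\<close> absorbs left multiplication (\<open>skew_mod_mult_right\<close>). Reducing the left factor is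
  harmless as soon as the right factor \<open>x\<close> maps \<open>f\<close> back into \<open>Rf\<close>, that is \<open>fx \<in> Rf\<close>
  (\<open>skew_mod_mult_left\<close>). For such an \<open>x\<close> both \<open>(yz)x\<close> and \<open>y(zx)\<close> are therefore the remainder of
  the associative product \<open>yzx\<close>, so \<open>x\<close> lies in the right nucleus (\<open>eigenspace_in_right_nucleus\<close>).

  It remains to see that \<open>f t^k \<in> Rf\<close>. Moving \<open>t^k\<close> past a coefficient applies \<open>\<sigma>^k\<close> to it, and the
  coefficients of \<open>f\<close> are fixed by \<open>\<sigma>^k\<close>; so \<open>t^k\<close> commutes with \<open>f\<close>, and \<open>f t^k = t^k f\<close>.
  By the same two reduction rules, \<open>t^m t^k\<close> and \<open>t^k t^m\<close> both equal the remainder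
  of \<open>t^(m+k)\<close>.
\<close>

lemma skew_mod_props:
  assumes "field_automorphism \<sigma>" and "degree f > 0"
  shows "degree (skew_mod \<sigma> g f) < degree f"
    and "\<exists>q. g = skew_mult \<sigma> q f + skew_mod \<sigma> g f"
  using theI'[OF ex1_skew_remainder[OF assms, of g]] by (simp_all add: skew_mod_def)

lemma skew_mod_unique:
  assumes "field_automorphism \<sigma>" and "degree r < degree f" and "g = skew_mult \<sigma> q f + r"
  shows "skew_mod \<sigma> g f = r"
proof -
  from assms(2) have "degree f > 0" by simp
  then show ?thesis
    unfolding skew_mod_def
    by (intro the1_equality[OF ex1_skew_remainder]) (use assms in auto)
qed

lemma skew_mod_add_left_multiple:
  assumes "field_automorphism \<sigma>" and "degree f > 0"
  shows "skew_mod \<sigma> (skew_mult \<sigma> q f + g) f = skew_mod \<sigma> g f"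
proof -
  obtain p where "g = skew_mult \<sigma> p f + skew_mod \<sigma> g f"
    using skew_mod_props(2)[OF assms] by blast
  then have "skew_mult \<sigma> q f + g = skew_mult \<sigma> (q + p) f + skew_mod \<sigma> g f"
    by (simp add: skew_mult_add_left[OF assms(1)] add.assoc)
  then show ?thesis
    using skew_mod_unique assms skew_mod_props(1) by blast
qed

lemma skew_mod_mult_right:
  assumes "field_automorphism \<sigma>" and "degree f > 0"
  shows "skew_mod \<sigma> (skew_mult \<sigma> p (skew_mod \<sigma> g f)) f = skew_mod \<sigma> (skew_mult \<sigma> p g) f"
proof -
  obtain q where q: "g = skew_mult \<sigma> q f + skew_mod \<sigma> g f"
    using skew_mod_props(2)[OF assms] by blast
  have "skew_mult \<sigma> p g
      = skew_mult \<sigma> (skew_mult \<sigma> p q) f + skew_mult \<sigma> p (skew_mod \<sigma> g f)"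
    by (subst q) (simp add: skew_mult_add_right[OF assms(1)] skew_mult_assoc[OF assms(1)])
  then show ?thesis
    by (simp add: skew_mod_add_left_multiple[OF assms])
qed

text \<open>
  If \<open>g\<close> differs from its remainder by \<open>qf\<close>, then right multiplication by \<open>x\<close> turns this difference
  into \<open>qfx\<close>; the condition on \<open>x\<close> is what puts \<open>qfx\<close> back into \<open>Rf\<close>.
\<close>

lemma skew_mod_mult_left:
  assumes "field_automorphism \<sigma>" and "degree f > 0"
    and "skew_mult \<sigma> f x = skew_mult \<sigma> u f"
  shows "skew_mod \<sigma> (skew_mult \<sigma> (skew_mod \<sigma> g f) x) f = skew_mod \<sigma> (skew_mult \<sigma> g x) f"
proof -
  obtain q where q: "g = skew_mult \<sigma> q f + skew_mod \<sigma> g f"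
    using skew_mod_props(2)[OF assms(1,2)] by blast
  have "skew_mult \<sigma> g x
      = skew_mult \<sigma> q (skew_mult \<sigma> f x) + skew_mult \<sigma> (skew_mod \<sigma> g f) x"
    by (subst q) (simp add: skew_mult_add_left[OF assms(1)] skew_mult_assoc[OF assms(1)])
  also have "skew_mult \<sigma> q (skew_mult \<sigma> f x) = skew_mult \<sigma> (skew_mult \<sigma> q u) f"
    by (simp add: assms(3) skew_mult_assoc[OF assms(1)])
  finally show ?thesis
    by (simp add: skew_mod_add_left_multiple[OF assms(1,2)])
qed

lemma eigenspace_in_right_nucleus:
  assumes "field_automorphism \<sigma>" and "degree x < degree f"
    and "skew_mult \<sigma> f x = skew_mult \<sigma> u f"
  shows "x \<in> right_nucleus (petit_algebra \<sigma> f)"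
proof -
  from assms(2) have "degree f > 0" by simp
  then show ?thesis
    using assms(2)
    by (simp add: right_nucleus_def petit_algebra_def skew_mod_mult_right[OF assms(1)]
        skew_mod_mult_left[OF assms(1) _ assms(3)] skew_mult_assoc[OF assms(1)])
qed

text \<open>
  In \<open>t^k p\<close> the coefficients of \<open>p\<close> are shifted by \<open>k\<close> and twisted by \<open>\<sigma>^k\<close>, whereas in \<open>p t^k\<close>
  they are only shifted.
\<close>

lemma monom_commutes_if_coeffs_fixed:
  assumes "field_automorphism \<sigma>" and "\<And>i. coeff p i \<in> Fix (\<sigma> ^^ k)"
  shows "skew_mult \<sigma> p (monom 1 k) = skew_mult \<sigma> (monom 1 k) p"
proof -
  have "skew_mult \<sigma> (monom (coeff p i) i) (monom 1 k)
      = skew_mult \<sigma> (monom 1 k) (monom (coeff p i) i)" for i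
    using assms(2)[of i]
    by (simp add: skew_mult_monom[OF assms(1)] funpow_aut_one[OF assms(1)] Fix_def add.commute)
  then have "skew_mult \<sigma> (\<Sum>i\<le>degree p. monom (coeff p i) i) (monom 1 k)
      = skew_mult \<sigma> (monom 1 k) (\<Sum>i\<le>degree p. monom (coeff p i) i)"
    by (simp add: skew_mult_sum_left[OF assms(1)] skew_mult_sum_right[OF assms(1)])
  then show ?thesis
    by (simp add: poly_as_sum_of_monoms)
qed

lemma coeff_monic_minus_lower_terms:
  "coeff (monom 1 m - (\<Sum>i<m. monom (a i) i)) n
    = (if n = m then 1 else if n < m then - a n else (0 :: 'a :: field))"
  by (simp add: coeff_sum)

lemma degree_monic_minus_lower_terms:
  "degree (monom 1 m - (\<Sum>i<m. monom (a i) i) :: 'a::field poly) = m"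
  by (intro antisym degree_le le_degree) (simp_all only: coeff_monic_minus_lower_terms, simp_all)

theorem theorem7:
  fixes \<sigma> :: "'a::field \<Rightarrow> 'a" and a :: "nat \<Rightarrow> 'a" and f :: "'a poly" and m k :: nat
  assumes "field_automorphism \<sigma>"
    and "m \<ge> 2"
    and "f = monom 1 m - (\<Sum>i<m. monom (a i) i)"
    and "\<not> right_invariant \<sigma> f"
    and "k \<in> {1..m - 1}"
    and "\<forall>i\<in>{0..m - 1}. a i \<in> Fix (\<sigma> ^^ k)"
  shows "monom 1 k \<in> right_nucleus (petit_algebra \<sigma> f) \<and>
    skew_mod \<sigma> (monom 1 m) f \<otimes>\<^bsub>petit_algebra \<sigma> f\<^esub> monom 1 k
      = monom 1 k \<otimes>\<^bsub>petit_algebra \<sigma> f\<^esub> skew_mod \<sigma> (monom 1 m) f"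
proof
  note aut = assms(1)
  have deg: "degree f = m"
    unfolding assms(3) by (rule degree_monic_minus_lower_terms)
  then have pos: "degree f > 0" using assms(2) by simp
  have fixed_neg: "(\<sigma> ^^ k) (- a i) = - a i" if "i < m" for i
  proof -
    have "(\<sigma> ^^ k) (a i) = a i"
      using assms(6) that by (simp add: Fix_def)
    then show ?thesis
      using funpow_aut_add[OF aut, of k "a i" "- a i"] funpow_aut_zero[OF aut, of k]
      by (simp add: eq_neg_iff_add_eq_0 add.commute)
  qed
  have "coeff f i \<in> Fix (\<sigma> ^^ k)" for i
    unfolding assms(3) coeff_monic_minus_lower_terms
    by (simp add: Fix_def fixed_neg funpow_aut_zero[OF aut] funpow_aut_one[OF aut])
  then have comm: "skew_mult \<sigma> f (monom 1 k) = skew_mult \<sigma> (monom 1 k) f"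
    by (rule monom_commutes_if_coeffs_fixed[OF aut])
  show "monom 1 k \<in> right_nucleus (petit_algebra \<sigma> f)"
  proof (rule eigenspace_in_right_nucleus[OF aut _ comm])
    show "degree (monom (1::'a) k) < degree f"
      using assms(2,5) deg by (auto simp: degree_monom_eq)
  qed
  show "skew_mod \<sigma> (monom 1 m) f \<otimes>\<^bsub>petit_algebra \<sigma> f\<^esub> monom 1 k
      = monom 1 k \<otimes>\<^bsub>petit_algebra \<sigma> f\<^esub> skew_mod \<sigma> (monom 1 m) f"
    by (simp add: petit_algebra_def skew_mod_mult_left[OF aut pos comm]
        skew_mod_mult_right[OF aut pos] skew_mult_monom[OF aut] funpow_aut_one[OF aut]
        add.commute)
qed

end
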